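(* Let $F\in H^{2}(0,\pi)$ be real-valued with $F(x)>0$ for all $x\in[0,\pi]$, and set $a(x)=\sqrt{F(x)}$, $q(x)=a''(x)/a(x)$, $h=a'(0)/a(0)$. Let $c$ be a real nonzero constant. Let $\{\mu_k^{2}\}_{k=0}^{\infty}$ be the spectrum of the Sturm–Liouville problem $-y''+q(x)y=\rho^{2}y$ on $(0,\pi)$, $y'(0)-hy(0)=0$, $y(\pi)=0$. For each $\rho\in\mathbb{C}$ with $\rho^{2}\neq\mu_k^{2}$ for all $k$, let $y(\rho,x)$ be the unique solution of $-y''+q(x)y=\rho^{2}y$ on $(0,\pi)$ with $y'(\rho,0)-hy(\rho,0)=c$ and $y(\rho,\pi)=0$, and put $f(\rho)=y(\rho,0)$. Let $\{g_n(\pi)\}_{n\ge 0}$ and $\{s_n(\pi)\}_{n\ge 0}$ be the values at $x=\pi$ of the Neumann series of Bessel functions coefficients of the solutions $\varphi(\rho,x)$ and $S(\rho,x)$ (defined in the context). Then: (i) for every $\rho\in\mathbb{C}\setminus\{0\}$ with $\rho^{2}\neq\mu_k^{2}$ for all $k$, $$f(\rho)\sum_{n=0}^{\infty}(-1)^{n}g_{n}(\pi)j_{2n}(\rho\pi)+\frac{c}{\rho}\sum_{n=0}^{\infty}(-1)^{n}s_{n}(\pi)j_{2n+1}(\rho\pi)=-f(\rho)\cos\rho\pi-c\,\frac{\sin\rho\pi}{\rho};$$ (ii) at $\rho=0$, $$f(0)g_{0}(\pi)+\frac{\pi c}{3}s_{0}(\pi)=-f(0)-\pi c;$$ (iii)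 if $\rho^{2}=\mu_k^{2}$ for some $k$, then $$\sum_{n=0}^{\infty}(-1)^{n}g_{n}(\pi)j_{2n}(\rho\pi)=-\cos\rho\pi.$$
   Context: Primes denote derivatives with respect to $x$, and $j_k$ denotes the spherical Bessel function of the first kind of order $k$. For $\rho\in\mathbb{C}$, $\varphi(\rho,x)$ and $S(\rho,x)$ are the solutions of $-y''+q(x)y=\rho^{2}y$ on $(0,\pi)$ with $\varphi(\rho,0)=1$, $\varphi'(\rho,0)=h$ and $S(\rho,0)=0$, $S'(\rho,0)=1$. It is a known fact that, for real-valued $q\in L_2(0,\pi)$ and real $h$, there are functions $g_n(x)$, $s_n(x)$, independent of $\rho$, such that $$\varphi(\rho,x)=\cos\rho x+\sum_{n=0}^{\infty}(-1)^{n}g_{n}(x)j_{2n}(\rho x),\qquad S(\rho,x)=\frac{\sin\rho x}{\rho}+\frac{1}{\rho}\sum_{n=0}^{\infty}(-1)^{n}s_{n}(x)j_{2n+1}(\rho x),$$ where the series converge pointwise for every $\rho\in\mathbb{C}$ and, for every $x\in[0,\pi]$, uniformly in $\rho$ on compact subsets of $\mathbb{C}$ (the expressions for $S$ at $\rho=0$ being understood as limits). The first coefficients are $g_0(x)=\varphi(0,x)-1$ and $s_0(x)=3\left(\frac{S(0,x)}{x}-1\right)$. The number $\rho=0$ is not an eigenvalue of the stated Sturm–Liouville problem, so $f(0)$ is defined. *)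

theory Defs
  imports "HOL-Analysis.Analysis"
begin

(* From j_k(z) = sqrt(pi/(2z)) J_{k+1/2}(z) and the power series of J_{k+1/2}; the series is
   entire in z, so no choice of branch for the two square roots is needed. *)
definition spherical_bessel_j :: "nat \<Rightarrow> complex \<Rightarrow> complex" where
  "spherical_bessel_j k z =
     of_real (sqrt pi / 2) *
       (\<Sum>m. (-1) ^ m / (fact m * Gamma (of_nat (m + k) + 3 / 2)) * (z / 2) ^ (2 * m + k))"

(* One-sided at the endpoints of [0,pi]. *)
definition ddx :: "(real \<Rightarrow> 'a::real_normed_vector) \<Rightarrow> real \<Rightarrow> 'a" where
  "ddx u x = vector_derivative u (at x within {0..pi})"

definition absolutely_continuous_on_interval ::
    "real \<Rightarrow> real \<Rightarrow> (real \<Rightarrow> 'a::real_normed_vector) \<Rightarrow> bool" where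
  "absolutely_continuous_on_interval a b u \<longleftrightarrow>
     (\<forall>\<epsilon>>0. \<exists>\<delta>>0. \<forall>\<D> X. \<D> division_of X \<and> X \<subseteq> {a..b} \<and> (\<Sum>K\<in>\<D>. Sup K - Inf K) < \<delta> \<longrightarrow>
        (\<Sum>K\<in>\<D>. norm (u (Sup K) - u (Inf K))) < \<epsilon>)"

definition square_integrable :: "(real \<Rightarrow> real) \<Rightarrow> bool" where
  "square_integrable u \<longleftrightarrow>
     set_borel_measurable lebesgue {0<..<pi} u \<and>
     set_integrable lebesgue {0<..<pi} (\<lambda>x. (u x)\<^sup>2)"

(* H^2(0,pi), each element being identified with its continuously differentiable representative
   on [0,pi]: u' is absolutely continuous and u'' lies in L_2(0,pi). Almost everywhere
   differentiability of u' is automatic by Lebesgue's theorem; it is spelled out because u'' is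
   the almost everywhere defined derivative of u'. *)
definition sobolev_H2 :: "(real \<Rightarrow> real) \<Rightarrow> bool" where
  "sobolev_H2 u \<longleftrightarrow>
     (\<forall>x\<in>{0..pi}. u differentiable (at x within {0..pi})) \<and>
     absolutely_continuous_on_interval 0 pi (ddx u) \<and>
     (AE x in lebesgue. x \<in> {0<..<pi} \<longrightarrow> ddx u differentiable (at x)) \<and>
     square_integrable (ddx (ddx u))"

(* -y'' + q y = \<nu> y on (0,pi) in the Caratheodory sense, as q is only defined almost everywhere. *)
definition sl_solution :: "(real \<Rightarrow> real) \<Rightarrow> complex \<Rightarrow> (real \<Rightarrow> complex) \<Rightarrow> bool" where
  "sl_solution q \<nu> y \<longleftrightarrow>
     (\<forall>x\<in>{0..pi}. y differentiable (at x within {0..pi})) \<and>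
     absolutely_continuous_on_interval 0 pi (ddx y) \<and>
     (AE x in lebesgue. x \<in> {0<..<pi} \<longrightarrow>
        ddx y differentiable (at x) \<and>
        - ddx (ddx y) x + of_real (q x) * y x = \<nu> * y x)"

definition sl_spectrum :: "(real \<Rightarrow> real) \<Rightarrow> real \<Rightarrow> complex set" where
  "sl_spectrum q h =
     {\<nu>. \<exists>y. sl_solution q \<nu> y \<and> (\<exists>x\<in>{0..pi}. y x \<noteq> 0) \<and>
          ddx y 0 - of_real h * y 0 = 0 \<and> y pi = 0}"

definition extend_to_0 :: "(complex \<Rightarrow> complex) \<Rightarrow> complex \<Rightarrow> complex" where
  "extend_to_0 G \<rho> = (if \<rho> = 0 then Lim (at 0) G else G \<rho>)"

definition nsbf_phi :: "(nat \<Rightarrow> real \<Rightarrow> complex) \<Rightarrow> (complex \<Rightarrow> real \<Rightarrow> complex) \<Rightarrow> bool" where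
  "nsbf_phi g \<phi> \<longleftrightarrow>
     (\<forall>x\<in>{0..pi}.
        (\<forall>\<rho>. (\<lambda>n. (-1) ^ n * g n x * spherical_bessel_j (2 * n) (\<rho> * of_real x))
                sums (\<phi> \<rho> x - cos (\<rho> * of_real x))) \<and>
        (\<forall>C. compact C \<longrightarrow>
           uniform_limit C
             (\<lambda>N \<rho>. \<Sum>n<N. (-1) ^ n * g n x * spherical_bessel_j (2 * n) (\<rho> * of_real x))
             (\<lambda>\<rho>. \<phi> \<rho> x - cos (\<rho> * of_real x)) sequentially))"

definition nsbf_S :: "(nat \<Rightarrow> real \<Rightarrow> complex) \<Rightarrow> (complex \<Rightarrow> real \<Rightarrow> complex) \<Rightarrow> bool" where
  "nsbf_S s S \<longleftrightarrow>
     (\<forall>x\<in>{0..pi}.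
        (\<forall>\<rho>. (\<lambda>n. (-1) ^ n * s n x *
                    extend_to_0 (\<lambda>r. spherical_bessel_j (2 * n + 1) (r * of_real x) / r) \<rho>)
                sums (S \<rho> x - extend_to_0 (\<lambda>r. sin (r * of_real x) / r) \<rho>)) \<and>
        (\<forall>C. compact C \<longrightarrow>
           uniform_limit C
             (\<lambda>N \<rho>. \<Sum>n<N. (-1) ^ n * s n x *
                extend_to_0 (\<lambda>r. spherical_bessel_j (2 * n + 1) (r * of_real x) / r) \<rho>)
             (\<lambda>\<rho>. S \<rho> x - extend_to_0 (\<lambda>r. sin (r * of_real x) / r) \<rho>) sequentially))"

end

theory Submission
  imports Defs
begin

text \<open>
  The functions \<open>y(\<rho>, \<cdot>)\<close> and \<open>f(\<rho>) \<phi>(\<rho>, \<cdot>) + c S(\<rho>, \<cdot>)\<close> solve the same linear equation with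
  the same Cauchy data at \<open>0\<close>, so they agree, and the condition at \<open>\<pi>\<close> reads
  \<open>f(\<rho>) \<phi>(\<rho>, \<pi>) + c S(\<rho>, \<pi>) = 0\<close>. Inserting the two Neumann series gives (i) and (ii); at \<open>\<rho> = 0\<close> only the terms with \<open>n = 0\<close> survive in (ii), because \<open>j\<^sub>k(0) = 0\<close> for \<open>k > 0\<close>
  and \<open>j\<^sub>k(r z) / r\<close> tends to \<open>z / 3\<close> for \<open>k = 1\<close> and to \<open>0\<close> for \<open>k > 1\<close>. If \<open>\<rho>\<^sup>2\<close> is in the spectrum, an
  eigenfunction is a nonzero multiple of \<open>\<phi>(\<rho>, \<cdot>)\<close>, hence \<open>\<phi>(\<rho>, \<pi>) = 0\<close>, which is (iii). The number
  \<open>0\<close> is not in the spectrum: \<open>\<phi>(0, \<cdot>) = a / a(0)\<close> has no zero.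

  All of this rests on uniqueness for the Cauchy problem (\<open>sl_solution_unique\<close>), where \<open>q\<close> is only
  defined almost everywhere. The zero-free solution \<open>v = a\<close> at spectral parameter \<open>0\<close> makes \<open>q\<close>
  disappear: in the Wronskian \<open>W = u' v - u v'\<close> of a solution \<open>u\<close> at \<open>\<nu>\<close> with \<open>v\<close> the terms containing \<open>q\<close>
  cancel, so that \<open>W' = - \<nu> u v\<close> almost everywhere. The function \<open>W\<close> is absolutely continuous, hence it
  is the integral of the continuous function \<open>- \<nu> u v\<close>
  (\<open>fundamental_theorem_of_calculus_absolutely_continuous\<close>) and is continuously differentiable. Thus
  \<open>(u, W)\<close> solves a first-order linear system with continuous coefficients, to which a Gronwall estimate
  applies.
\<close>

section \<open>Absolutely continuous functions\<close>

text \<open>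
  The closure properties below all reduce to this comparison: sums, products and congruences are
  dominated by their ingredients, and Lipschitz functions by the identity.
\<close>
lemma absolutely_continuous_dominated:
  fixes f :: "real \<Rightarrow> 'a::real_normed_vector" and g :: "real \<Rightarrow> 'b::real_normed_vector"
    and k :: "real \<Rightarrow> 'c::real_normed_vector"
  assumes f: "absolutely_continuous_on_interval a b f"
    and g: "absolutely_continuous_on_interval a b g"
    and dom: "\<And>s t. s \<in> {a..b} \<Longrightarrow> t \<in> {a..b} \<Longrightarrow>
      norm (k t - k s) \<le> C * (norm (f t - f s) + norm (g t - g s))"
  shows "absolutely_continuous_on_interval a b k"
  unfolding absolutely_continuous_on_interval_def
proof (intro allI impI)
  fix e :: real assume "e > 0"
  define B where "B = \<bar>C\<bar> + 1"
  have B: "B > 0" by (simp add: B_def)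
  have eB: "e / (2 * B) > 0" using \<open>e > 0\<close> B by simp
  obtain d1 where d1: "d1 > 0" "\<And>\<D> X. \<D> division_of X \<Longrightarrow> X \<subseteq> {a..b} \<Longrightarrow>
      (\<Sum>K\<in>\<D>. Sup K - Inf K) < d1 \<Longrightarrow> (\<Sum>K\<in>\<D>. norm (f (Sup K) - f (Inf K))) < e / (2 * B)"
    using f eB unfolding absolutely_continuous_on_interval_def by meson
  obtain d2 where d2: "d2 > 0" "\<And>\<D> X. \<D> division_of X \<Longrightarrow> X \<subseteq> {a..b} \<Longrightarrow>
      (\<Sum>K\<in>\<D>. Sup K - Inf K) < d2 \<Longrightarrow> (\<Sum>K\<in>\<D>. norm (g (Sup K) - g (Inf K))) < e / (2 * B)"
    using g eB unfolding absolutely_continuous_on_interval_def by meson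
  have "(\<Sum>K\<in>\<D>. norm (k (Sup K) - k (Inf K))) < e"
    if D: "\<D> division_of X" "X \<subseteq> {a..b}" "(\<Sum>K\<in>\<D>. Sup K - Inf K) < min d1 d2" for \<D> X
  proof -
    have "norm (k (Sup K) - k (Inf K))
        \<le> B * (norm (f (Sup K) - f (Inf K)) + norm (g (Sup K) - g (Inf K)))" if "K \<in> \<D>" for K
    proof -
      obtain u v where K: "K = {u..v}"
        using division_ofD(4)[OF D(1) \<open>K \<in> \<D>\<close>] by auto
      have "u \<le> v" using division_ofD(3)[OF D(1) \<open>K \<in> \<D>\<close>] K by auto
      have "K \<subseteq> {a..b}" using division_ofD(2)[OF D(1) \<open>K \<in> \<D>\<close>] D(2) by blast
      then have "u \<in> {a..b}" "v \<in> {a..b}" using K \<open>u \<le> v\<close> by auto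
      then have "norm (k v - k u) \<le> C * (norm (f v - f u) + norm (g v - g u))"
        by (intro dom)
      also have "\<dots> \<le> B * (norm (f v - f u) + norm (g v - g u))"
        by (intro mult_right_mono) (auto simp: B_def)
      finally show ?thesis using K \<open>u \<le> v\<close> by simp
    qed
    then have "(\<Sum>K\<in>\<D>. norm (k (Sup K) - k (Inf K)))
        \<le> (\<Sum>K\<in>\<D>. B * (norm (f (Sup K) - f (Inf K)) + norm (g (Sup K) - g (Inf K))))"
      by (rule sum_mono)
    also have "\<dots> = B * ((\<Sum>K\<in>\<D>. norm (f (Sup K) - f (Inf K))) + (\<Sum>K\<in>\<D>. norm (g (Sup K) - g (Inf K))))"
      by (simp add: sum.distrib flip: sum_distrib_left)
    also have "\<dots> < B * (e / (2 * B) + e / (2 * B))"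
      using d1(2)[OF D(1,2)] d2(2)[OF D(1,2)] D(3) B by (intro mult_strict_left_mono add_strict_mono) auto
    also have "\<dots> = e" using B by (simp add: field_simps)
    finally show ?thesis .
  qed
  then show "\<exists>d>0. \<forall>\<D> X. \<D> division_of X \<and> X \<subseteq> {a..b} \<and> (\<Sum>K\<in>\<D>. Sup K - Inf K) < d \<longrightarrow>
        (\<Sum>K\<in>\<D>. norm (k (Sup K) - k (Inf K))) < e"
    using d1(1) d2(1) by (intro exI[of _ "min d1 d2"]) auto
qed

lemma absolutely_continuous_ident: "absolutely_continuous_on_interval a b (\<lambda>x::real. x)"
  unfolding absolutely_continuous_on_interval_def
proof (intro allI impI)
  fix e :: real assume "e > 0"
  have "(\<Sum>K\<in>\<D>. norm (Sup K - Inf K)) = (\<Sum>K\<in>\<D>. Sup K - Inf K)"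
    if D: "\<D> division_of X" for \<D> and X :: "real set"
  proof (rule sum.cong[OF refl])
    fix K assume "K \<in> \<D>"
    obtain u v where "K = {u..v}"
      using division_ofD(4)[OF D \<open>K \<in> \<D>\<close>] by auto
    moreover from this have "u \<le> v"
      using division_ofD(3)[OF D \<open>K \<in> \<D>\<close>] by auto
    ultimately show "norm (Sup K - Inf K) = Sup K - Inf K" by simp
  qed
  then show "\<exists>d>0. \<forall>\<D> X. \<D> division_of X \<and> X \<subseteq> {a..b} \<and> (\<Sum>K\<in>\<D>. Sup K - Inf K) < d \<longrightarrow>
        (\<Sum>K\<in>\<D>. norm (Sup K - Inf K)) < e"
    using \<open>e > 0\<close> by (intro exI[of _ e]) (auto simp del: real_norm_def)
qed

lemma absolutely_continuous_const: "absolutely_continuous_on_interval a b (\<lambda>x. c)"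
  by (rule absolutely_continuous_dominated[OF absolutely_continuous_ident absolutely_continuous_ident,
        where C = 0]) simp

lemma absolutely_continuous_subinterval:
  assumes "absolutely_continuous_on_interval a b f" "{c..d} \<subseteq> {a..b}"
  shows "absolutely_continuous_on_interval c d f"
  using assms unfolding absolutely_continuous_on_interval_def by (meson order_trans)

lemma absolutely_continuous_imp_continuous_on:
  fixes f :: "real \<Rightarrow> 'a::real_normed_vector"
  assumes f: "absolutely_continuous_on_interval a b f"
  shows "continuous_on {a..b} f"
  unfolding continuous_on_iff
proof (intro ballI allI impI)
  fix x e :: real assume x: "x \<in> {a..b}" and "e > 0"
  then obtain d where d: "d > 0" "\<And>\<D> X. \<D> division_of X \<Longrightarrow> X \<subseteq> {a..b} \<Longrightarrow>
      (\<Sum>K\<in>\<D>. Sup K - Inf K) < d \<Longrightarrow> (\<Sum>K\<in>\<D>. norm (f (Sup K) - f (Inf K))) < e"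
    using f unfolding absolutely_continuous_on_interval_def by meson
  have *: "norm (f t - f s) < e" if "s \<in> {a..b}" "t \<in> {a..b}" "s \<le> t" "t - s < d" for s t
  proof -
    have "{{s..t}} division_of {s..t}" using \<open>s \<le> t\<close> division_of_self[of s t] by auto
    from d(2)[OF this] that show ?thesis by auto
  qed
  have "dist (f x') (f x) < e" if "x' \<in> {a..b}" "dist x' x < d" for x'
    using *[of x x'] *[of x' x] that x by (cases "x \<le> x'") (auto simp: dist_norm norm_minus_commute)
  then show "\<exists>d>0. \<forall>x'\<in>{a..b}. dist x' x < d \<longrightarrow> dist (f x') (f x) < e"
    using d(1) by blast
qed

lemma continuous_on_interval_bounded:
  fixes f :: "real \<Rightarrow> 'a::real_normed_vector"
  assumes "continuous_on {a..b} f"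
  obtains B where "B \<ge> 0" "\<And>x. x \<in> {a..b} \<Longrightarrow> norm (f x) \<le> B"
proof -
  have "bounded (f ` {a..b})"
    using assms by (intro compact_imp_bounded compact_continuous_image) auto
  then obtain B where "\<forall>x\<in>{a..b}. norm (f x) \<le> B" by (auto simp: bounded_iff)
  then show ?thesis using that[of "\<bar>B\<bar>"] by force
qed

lemma absolutely_continuous_diff:
  fixes f g :: "real \<Rightarrow> 'a::real_normed_vector"
  assumes "absolutely_continuous_on_interval a b f" "absolutely_continuous_on_interval a b g"
  shows "absolutely_continuous_on_interval a b (\<lambda>x. f x - g x)"
  using assms
proof (rule absolutely_continuous_dominated)
  show "norm ((f t - g t) - (f s - g s)) \<le> 1 * (norm (f t - f s) + norm (g t - g s))" for s t
    using norm_triangle_ineq4[of "f t - f s" "g t - g s"] by (simp add: algebra_simps)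
qed

lemma absolutely_continuous_add:
  fixes f g :: "real \<Rightarrow> 'a::real_normed_vector"
  assumes "absolutely_continuous_on_interval a b f" "absolutely_continuous_on_interval a b g"
  shows "absolutely_continuous_on_interval a b (\<lambda>x. f x + g x)"
  using assms
proof (rule absolutely_continuous_dominated)
  show "norm ((f t + g t) - (f s + g s)) \<le> 1 * (norm (f t - f s) + norm (g t - g s))" for s t
    using norm_triangle_ineq[of "f t - f s" "g t - g s"] by (simp add: algebra_simps)
qed

lemma absolutely_continuous_mult:
  fixes f g :: "real \<Rightarrow> 'a::real_normed_algebra"
  assumes f: "absolutely_continuous_on_interval a b f"
    and g: "absolutely_continuous_on_interval a b g"
  shows "absolutely_continuous_on_interval a b (\<lambda>x. f x * g x)"
proof -
  obtain A where A: "A \<ge> 0" "\<And>x. x \<in> {a..b} \<Longrightarrow> norm (f x) \<le> A"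
    using continuous_on_interval_bounded[OF absolutely_continuous_imp_continuous_on[OF f]] by blast
  obtain B where B: "B \<ge> 0" "\<And>x. x \<in> {a..b} \<Longrightarrow> norm (g x) \<le> B"
    using continuous_on_interval_bounded[OF absolutely_continuous_imp_continuous_on[OF g]] by blast
  show ?thesis
    using f g
  proof (rule absolutely_continuous_dominated)
    fix s t assume st: "s \<in> {a..b}" "t \<in> {a..b}"
    have "norm (f t * g t - f s * g s) = norm ((f t - f s) * g t + f s * (g t - g s))"
      by (simp add: algebra_simps)
    also have "\<dots> \<le> norm (f t - f s) * norm (g t) + norm (f s) * norm (g t - g s)"
      by (meson add_mono norm_mult_ineq norm_triangle_ineq order_trans)
    also have "\<dots> \<le> norm (f t - f s) * (A + B) + (A + B) * norm (g t - g s)"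
      using A(1) A(2)[OF st(1)] B(1) B(2)[OF st(2)]
      by (intro add_mono mult_left_mono mult_right_mono) auto
    finally show "norm (f t * g t - f s * g s) \<le> (A + B) * (norm (f t - f s) + norm (g t - g s))"
      by (simp add: algebra_simps)
  qed
qed

lemma absolutely_continuous_C1:
  fixes f :: "real \<Rightarrow> 'a::real_normed_vector"
  assumes deriv: "\<And>x. x \<in> {a..b} \<Longrightarrow> (f has_vector_derivative f' x) (at x within {a..b})"
    and cont: "continuous_on {a..b} f'"
  shows "absolutely_continuous_on_interval a b f"
proof -
  obtain B where B: "\<And>x. x \<in> {a..b} \<Longrightarrow> norm (f' x) \<le> B"
    using continuous_on_interval_bounded[OF cont] by blast
  have lip: "norm (f t - f s) \<le> B * norm (t - s)" if "s \<in> {a..b}" "t \<in> {a..b}" for s t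
  proof (rule differentiable_bound)
    show "(f has_derivative (\<lambda>u. u *\<^sub>R f' x)) (at x within {a..b})" if "x \<in> {a..b}" for x
      using deriv[OF that] by (simp add: has_vector_derivative_def)
    show "onorm (\<lambda>u. u *\<^sub>R f' x) \<le> B" if "x \<in> {a..b}" for x
      using B[OF that] by (intro onorm_le) (simp add: mult.commute[of _ "norm (f' x)"] mult_right_mono)
  qed (use that in auto)
  show ?thesis
  proof (rule absolutely_continuous_dominated[OF absolutely_continuous_ident absolutely_continuous_ident])
    show "norm (f t - f s) \<le> B / 2 * (norm (t - s) + norm (t - s))" if "s \<in> {a..b}" "t \<in> {a..b}" for s t
      using lip[OF that] by simp
  qed
qed

text \<open>
  On a fine tagged division the Riemann sum is compared with the sum of the increments of \<open>f\<close>. The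
  intervals tagged outside the exceptional set are controlled by differentiability at the tag. Those
  tagged inside it can be forced into an open set of small measure; their total length is then small,
  and absolute continuity bounds the sum of their increments.
\<close>
lemma fundamental_theorem_of_calculus_absolutely_continuous:
  fixes f :: "real \<Rightarrow> 'a::euclidean_space"
  assumes "a \<le> b"
    and ac: "absolutely_continuous_on_interval a b f"
    and N: "negligible N"
    and deriv: "\<And>x. x \<in> {a<..<b} - N \<Longrightarrow> (f has_vector_derivative f' x) (at x)"
  shows "(f' has_integral (f b - f a)) {a..b}"
proof (cases "a = b")
  case True
  then show ?thesis using has_integral_refl(2)[of f' b] by simp
next
  case False
  with \<open>a \<le> b\<close> have "a < b" by simp
  \<comment> \<open>The end points join the exceptional set because no derivative is assumed there.\<close>
  define M where "M = N \<union> {a, b}"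
  have M: "negligible M" unfolding M_def using N by simp
  define k where "k x = (if x \<in> M then 0 else f' x)" for x
  have "(k has_integral (f b - f a)) {a..b}"
    unfolding has_integral_factor_content_real
  proof (intro allI impI)
    fix e :: real assume "e > 0"
    define \<epsilon> where "\<epsilon> = e * (b - a) / 2"
    have "\<epsilon> > 0" using \<open>e > 0\<close> \<open>a < b\<close> by (simp add: \<epsilon>_def)
    then obtain \<delta> where \<delta>: "\<delta> > 0" "\<And>\<D> X. \<D> division_of X \<Longrightarrow> X \<subseteq> {a..b} \<Longrightarrow>
        (\<Sum>K\<in>\<D>. Sup K - Inf K) < \<delta> \<Longrightarrow> (\<Sum>K\<in>\<D>. norm (f (Sup K) - f (Inf K))) < \<epsilon>"
      using ac unfolding absolutely_continuous_on_interval_def by meson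
    have Mnull: "M \<in> null_sets lebesgue" using M by (simp add: negligible_iff_null_sets)
    then obtain U where U: "open U" "M \<subseteq> U" "U - M \<in> lmeasurable" "emeasure lebesgue (U - M) < ennreal \<delta>"
      using sets_lebesgue_outer_open[of M \<delta>] \<delta>(1) by auto
    have Ueq: "U = (U - M) \<union> M" using U(2) by auto
    have "M \<in> lmeasurable" using M by (simp add: negligible_imp_measurable)
    then have Ulm: "U \<in> lmeasurable" using U(3) Ueq by (metis fmeasurable.Un)
    have "emeasure lebesgue U = emeasure lebesgue (U - M)"
      using emeasure_Un_null_set[of "U - M" lebesgue M] U(3) Mnull Ueq by (simp add: fmeasurable_def)
    then have "ennreal (measure lebesgue U) < ennreal \<delta>"
      using U(4) emeasure_eq_measure2[OF Ulm] by simp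
    then have Umeas: "measure lebesgue U < \<delta>" by (simp add: ennreal_less_iff)
    have "\<exists>d>0. (x \<in> M \<longrightarrow> ball x d \<subseteq> U) \<and> (x \<in> {a..b} - M \<longrightarrow>
        (\<forall>y. norm (y - x) < d \<longrightarrow> norm (f y - f x - (y - x) *\<^sub>R f' x) \<le> e / 2 * norm (y - x)))" for x
    proof (cases "x \<in> M")
      case True
      then show ?thesis using U(1,2) by (auto simp: open_contains_ball)
    next
      case xM: False
      show ?thesis
      proof (cases "x \<in> {a..b}")
        case True
        then have "(f has_vector_derivative f' x) (at x)"
          using xM by (intro deriv) (auto simp: M_def)
        then have "\<exists>d>0. \<forall>y. norm (y - x) < d \<longrightarrow> norm (f y - f x - (y - x) *\<^sub>R f' x) \<le> e / 2 * norm (y - x)"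
          using half_gt_zero[OF \<open>e > 0\<close>] unfolding has_vector_derivative_def has_derivative_within_alt
          by blast
        then show ?thesis using xM by auto
      next
        case False
        then show ?thesis using xM by (intro exI[of _ 1]) auto
      qed
    qed
    then obtain d where d: "\<And>x. d x > 0" "\<And>x. x \<in> M \<Longrightarrow> ball x (d x) \<subseteq> U"
      "\<And>x y. x \<in> {a..b} - M \<Longrightarrow> norm (y - x) < d x \<Longrightarrow>
          norm (f y - f x - (y - x) *\<^sub>R f' x) \<le> e / 2 * norm (y - x)"
      by metis
    have "norm ((\<Sum>(x, K)\<in>p. measure lborel K *\<^sub>R k x) - (f b - f a)) \<le> e * measure lborel {a..b}"
      if p: "p tagged_division_of {a..b}" and fine: "(\<lambda>x. ball x (d x)) fine p" for p
    proof -
      define p1 where "p1 = {z \<in> p. fst z \<in> M}"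
      have p1p: "p1 \<subseteq> p" by (auto simp: p1_def)
      have finp: "finite p" using p by blast
      have Kform: "\<exists>u v. K = {u..v} \<and> u \<le> v \<and> x \<in> {u..v} \<and> {u..v} \<subseteq> {a..b} \<and> {u..v} \<subseteq> ball x (d x)"
        if xK: "(x, K) \<in> p" for x K
      proof -
        obtain u v where "K = {u..v}" using tagged_division_ofD(4)[OF p xK] by auto
        moreover have "x \<in> K" "K \<subseteq> {a..b}" using tagged_division_ofD(2,3)[OF p xK] by auto
        moreover have "K \<subseteq> ball x (d x)" using fine xK by blast
        ultimately show ?thesis by (intro exI[of _ u] exI[of _ v]) auto
      qed
      let ?D = "snd ` p1"
      have part: "p1 tagged_partial_division_of {a..b}"
        using p p1p tagged_partial_division_subset by (auto simp: tagged_division_of_def)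
      have div: "?D division_of \<Union>?D"
        by (rule partial_division_of_tagged_division[OF part])
      have sub: "\<Union>?D \<subseteq> {a..b}"
        using Kform p1p by fastforce
      have "\<Union>?D \<subseteq> U"
      proof
        fix y assume "y \<in> \<Union>?D"
        then obtain x K where xK: "(x, K) \<in> p1" "y \<in> K" by auto
        then have "x \<in> M" "(x, K) \<in> p" by (auto simp: p1_def)
        then show "y \<in> U" using Kform[of x K] d(2)[of x] xK(2) by blast
      qed
      then have "measure lebesgue (\<Union>?D) \<le> measure lebesgue U"
        using Ulm lmeasurable_division[OF div] by (intro measure_mono_fmeasurable) auto
      moreover have "(\<Sum>K\<in>?D. Sup K - Inf K) = (\<Sum>K\<in>?D. measure lebesgue K)"
      proof (rule sum.cong[OF refl])
        fix K assume "K \<in> ?D"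
        then obtain u v where "K = {u..v}" "u \<le> v" using Kform p1p by force
        then show "Sup K - Inf K = measure lebesgue K" by simp
      qed
      ultimately have "(\<Sum>K\<in>?D. Sup K - Inf K) < \<delta>"
        using Umeas content_division[OF div] by simp
      then have small: "(\<Sum>K\<in>?D. norm (f (Sup K) - f (Inf K))) < \<epsilon>"
        using \<delta>(2)[OF div sub] by simp
      \<comment> \<open>The convention at the empty set makes the increment vanish on every degenerate box, which is
        what regrouping a sum over a tagged division requires.\<close>
      define \<Delta> where "\<Delta> K = (if K = {} then 0 else norm (f (Sup K) - f (Inf K)))" for K
      have "(\<Sum>(x,K)\<in>p1. \<Delta> K) = (\<Sum>K\<in>?D. \<Delta> K)"
      proof (rule sum.over_tagged_division_lemma)
        show "p1 tagged_division_of \<Union>?D"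
          by (rule tagged_partial_division_of_Union_self[OF part])
        show "\<Delta> (cbox u v) = 0" if "box u v = {}" for u v :: real
          using that by (cases "u = v") (auto simp: \<Delta>_def)
      qed
      also have "\<dots> = (\<Sum>K\<in>?D. norm (f (Sup K) - f (Inf K)))"
        using division_ofD(3)[OF div] by (intro sum.cong) (auto simp: \<Delta>_def)
      finally have s1: "(\<Sum>(x,K)\<in>p1. \<Delta> K) < \<epsilon>" using small by simp
      have n1: "norm (measure lborel K *\<^sub>R k x - (f (Sup K) - f (Inf K))) \<le> \<Delta> K" if "(x, K) \<in> p1" for x K
        using that Kform[of x K] by (auto simp: p1_def k_def \<Delta>_def norm_minus_commute)
      have n2: "norm (measure lborel K *\<^sub>R k x - (f (Sup K) - f (Inf K))) \<le> e / 2 * (Sup K - Inf K)"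
        if "(x, K) \<in> p - p1" for x K
      proof -
        have xM: "x \<notin> M" and xKp: "(x, K) \<in> p" using that by (auto simp: p1_def)
        obtain u v where K: "K = {u..v}" "u \<le> v" "x \<in> {u..v}" "{u..v} \<subseteq> {a..b}" "{u..v} \<subseteq> ball x (d x)"
          using Kform[OF xKp] by auto
        have x: "x \<in> {a..b} - M" using K xM by auto
        have "u \<in> ball x (d x)" "v \<in> ball x (d x)"
          using K(2) by (auto intro!: subsetD[OF K(5)] simp del: mem_ball)
        then have u: "norm (u - x) < d x" and v: "norm (v - x) < d x"
          by (auto simp: dist_real_def)
        have "norm ((v - u) *\<^sub>R f' x - (f v - f u))
            = norm ((f u - f x - (u - x) *\<^sub>R f' x) - (f v - f x - (v - x) *\<^sub>R f' x))"
          by (auto simp: algebra_simps)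
        also have "\<dots> \<le> norm (f u - f x - (u - x) *\<^sub>R f' x) + norm (f v - f x - (v - x) *\<^sub>R f' x)"
          by (rule norm_triangle_ineq4)
        also have "\<dots> \<le> e / 2 * norm (u - x) + e / 2 * norm (v - x)"
          by (intro add_mono d(3) x u v)
        also have "\<dots> = e / 2 * (v - u)" using K by (auto simp: field_simps)
        finally show ?thesis using K xM by (simp add: k_def)
      qed
      have incr: "f b - f a = (\<Sum>(x,K)\<in>p. f (Sup K) - f (Inf K))" "b - a = (\<Sum>(x,K)\<in>p. Sup K - Inf K)"
        using additive_tagged_division_1[OF \<open>a \<le> b\<close> p, of f] additive_tagged_division_1[OF \<open>a \<le> b\<close> p, of "\<lambda>x. x"]
        by auto
      have "(\<Sum>(x,K)\<in>p. measure lborel K *\<^sub>R k x) - (f b - f a)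
          = (\<Sum>(x,K)\<in>p. measure lborel K *\<^sub>R k x - (f (Sup K) - f (Inf K)))"
        by (simp add: incr(1) sum_subtractf split_def)
      then have "norm ((\<Sum>(x,K)\<in>p. measure lborel K *\<^sub>R k x) - (f b - f a))
          \<le> (\<Sum>(x,K)\<in>p. norm (measure lborel K *\<^sub>R k x - (f (Sup K) - f (Inf K))))"
        by (simp add: split_def norm_sum)
      also have "\<dots> = (\<Sum>(x,K)\<in>p1. norm (measure lborel K *\<^sub>R k x - (f (Sup K) - f (Inf K))))
          + (\<Sum>(x,K)\<in>p - p1. norm (measure lborel K *\<^sub>R k x - (f (Sup K) - f (Inf K))))"
        using sum.subset_diff[OF p1p finp] by (simp add: add.commute)
      also have "\<dots> \<le> (\<Sum>(x,K)\<in>p1. \<Delta> K) + (\<Sum>(x,K)\<in>p - p1. e / 2 * (Sup K - Inf K))"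
        using n1 n2 by (intro add_mono sum_mono) auto
      also have "(\<Sum>(x,K)\<in>p - p1. e / 2 * (Sup K - Inf K)) \<le> (\<Sum>(x,K)\<in>p. e / 2 * (Sup K - Inf K))"
      proof (rule sum_mono2)
        show "0 \<le> (case z of (x, K) \<Rightarrow> e / 2 * (Sup K - Inf K))" if "z \<in> p - (p - p1)" for z
          using Kform[of "fst z" "snd z"] that \<open>e > 0\<close> by (auto simp: split_def p1_def)
      qed (use finp in auto)
      also have "(\<Sum>(x,K)\<in>p. e / 2 * (Sup K - Inf K)) = e / 2 * (b - a)"
        by (simp add: incr(2) sum_distrib_left split_def)
      finally show ?thesis using s1 \<open>a < b\<close> by (simp add: \<epsilon>_def)
    qed
    moreover have "gauge (\<lambda>x. ball x (d x))" using d(1) gauge_ball_dependent by blast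
    ultimately show "\<exists>\<gamma>. gauge \<gamma> \<and> (\<forall>p. p tagged_division_of {a..b} \<and> \<gamma> fine p \<longrightarrow>
        norm ((\<Sum>(x, K)\<in>p. measure lborel K *\<^sub>R k x) - (f b - f a)) \<le> e * measure lborel {a..b})"
      by blast
  qed
  then show ?thesis
    by (rule has_integral_spike[OF M, rotated]) (simp add: k_def)
qed

section \<open>Caratheodory solutions and their Wronskians\<close>

lemma has_vector_derivative_ddx:
  "u differentiable (at x within {0..pi}) \<Longrightarrow> (u has_vector_derivative ddx u x) (at x within {0..pi})"
  unfolding ddx_def by (simp add: vector_derivative_works)

lemma ddx_eq:
  assumes "(u has_vector_derivative u') (at x within {0..pi})" "x \<in> {0..pi}"
  shows "ddx u x = u'"
  using vector_derivative_within_cbox[of 0 pi x u u'] assms by (simp add: ddx_def)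

lemma has_vector_derivative_ddx_at:
  assumes "u differentiable (at x)" "x \<in> {0<..<pi}"
  shows "(u has_vector_derivative ddx u x) (at x)"
proof -
  have "at x within {0..pi} = at x"
    using assms(2) by (intro at_within_Icc_at) auto
  then show ?thesis using has_vector_derivative_ddx[of u x] assms(1) by simp
qed

text \<open>
  Where no derivative exists, \<^const>\<open>ddx\<close> takes an arbitrary value and obeys no calculus rules. This
  criterion and its converse below replace it by explicit derivatives, to which those rules apply.
\<close>
lemma sl_solutionI:
  assumes deriv: "\<And>x. x \<in> {0..pi} \<Longrightarrow> (y has_vector_derivative y' x) (at x within {0..pi})"
    and ac: "absolutely_continuous_on_interval 0 pi y'"
    and ode: "AE x in lebesgue. x \<in> {0<..<pi} \<longrightarrow>
      (y' has_vector_derivative (of_real (q x) - \<nu>) * y x) (at x)"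
  shows "sl_solution q \<nu> y"
  unfolding sl_solution_def
proof (intro conjI ballI)
  have eq: "ddx y x = y' x" if "x \<in> {0..pi}" for x
    using ddx_eq[OF deriv[OF that] that] .
  show "y differentiable at x within {0..pi}" if "x \<in> {0..pi}" for x
    using deriv[OF that] by (rule differentiableI_vector)
  show "absolutely_continuous_on_interval 0 pi (ddx y)"
    by (rule absolutely_continuous_dominated[OF ac ac, where C = 1]) (simp add: eq)
  show "AE x in lebesgue. x \<in> {0<..<pi} \<longrightarrow>
        ddx y differentiable (at x) \<and> - ddx (ddx y) x + of_real (q x) * y x = \<nu> * y x"
    using ode
  proof (rule AE_mp, intro AE_I2 impI)
    fix x assume *: "x \<in> {0<..<pi} \<longrightarrow> (y' has_vector_derivative (of_real (q x) - \<nu>) * y x) (at x)"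
      and x: "x \<in> {0<..<pi}"
    have d: "(ddx y has_vector_derivative (of_real (q x) - \<nu>) * y x) (at x)"
      by (rule has_vector_derivative_transform_within_open[of y' _ x "{0<..<pi}"])
        (use * x eq in auto)
    then have "ddx (ddx y) x = (of_real (q x) - \<nu>) * y x"
      using ddx_eq[OF has_vector_derivative_at_within[OF d]] x by simp
    then show "ddx y differentiable (at x) \<and> - ddx (ddx y) x + of_real (q x) * y x = \<nu> * y x"
      using differentiableI_vector[OF d] by (simp add: algebra_simps)
  qed
qed

lemma sl_solutionD:
  assumes "sl_solution q \<nu> y"
  shows "\<And>x. x \<in> {0..pi} \<Longrightarrow> (y has_vector_derivative ddx y x) (at x within {0..pi})"
    and "absolutely_continuous_on_interval 0 pi (ddx y)"
    and "AE x in lebesgue. x \<in> {0<..<pi} \<longrightarrow>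
      (ddx y has_vector_derivative (of_real (q x) - \<nu>) * y x) (at x)"
proof -
  show "(y has_vector_derivative ddx y x) (at x within {0..pi})" if "x \<in> {0..pi}" for x
    using assms that by (auto simp: sl_solution_def intro: has_vector_derivative_ddx)
  show "absolutely_continuous_on_interval 0 pi (ddx y)"
    using assms by (simp add: sl_solution_def)
  have "AE x in lebesgue. x \<in> {0<..<pi} \<longrightarrow>
        ddx y differentiable (at x) \<and> - ddx (ddx y) x + of_real (q x) * y x = \<nu> * y x"
    using assms by (simp add: sl_solution_def)
  then show "AE x in lebesgue. x \<in> {0<..<pi} \<longrightarrow>
      (ddx y has_vector_derivative (of_real (q x) - \<nu>) * y x) (at x)"
  proof (rule AE_mp, intro AE_I2 impI)
    fix x assume *: "x \<in> {0<..<pi} \<longrightarrow>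
        ddx y differentiable (at x) \<and> - ddx (ddx y) x + of_real (q x) * y x = \<nu> * y x"
      and x: "x \<in> {0<..<pi}"
    then have "ddx (ddx y) x = (of_real (q x) - \<nu>) * y x"
      by (auto simp: algebra_simps)
    then show "(ddx y has_vector_derivative (of_real (q x) - \<nu>) * y x) (at x)"
      using has_vector_derivative_ddx_at[of "ddx y" x] * x by auto
  qed
qed

lemma ddx_combination:
  assumes "sl_solution q \<nu> u" "sl_solution q \<kappa> v" "x \<in> {0..pi}"
  shows "ddx (\<lambda>x. \<alpha> * u x + \<beta> * v x) x = \<alpha> * ddx u x + \<beta> * ddx v x"
  by (intro ddx_eq derivative_intros sl_solutionD(1)[OF assms(1)] sl_solutionD(1)[OF assms(2)] assms(3))

lemma sl_solution_combination:
  assumes u: "sl_solution q \<nu> u" and v: "sl_solution q \<nu> v"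
  shows "sl_solution q \<nu> (\<lambda>x. \<alpha> * u x + \<beta> * v x)"
proof (rule sl_solutionI[where y' = "\<lambda>x. \<alpha> * ddx u x + \<beta> * ddx v x"])
  show "((\<lambda>x. \<alpha> * u x + \<beta> * v x) has_vector_derivative \<alpha> * ddx u x + \<beta> * ddx v x) (at x within {0..pi})"
    if "x \<in> {0..pi}" for x
    using that by (intro derivative_intros sl_solutionD(1)[OF u] sl_solutionD(1)[OF v])
  show "absolutely_continuous_on_interval 0 pi (\<lambda>x. \<alpha> * ddx u x + \<beta> * ddx v x)"
    by (intro absolutely_continuous_add absolutely_continuous_mult absolutely_continuous_const
        sl_solutionD(2)[OF u] sl_solutionD(2)[OF v])
  show "AE x in lebesgue. x \<in> {0<..<pi} \<longrightarrow> ((\<lambda>x. \<alpha> * ddx u x + \<beta> * ddx v x)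
      has_vector_derivative (of_real (q x) - \<nu>) * (\<alpha> * u x + \<beta> * v x)) (at x)"
    using sl_solutionD(3)[OF u] sl_solutionD(3)[OF v]
  proof eventually_elim
    case (elim x)
    then show ?case
      by (auto intro!: derivative_eq_intros simp: algebra_simps)
  qed
qed

lemma continuous_on_sl_solution:
  assumes "sl_solution q \<nu> y"
  shows "continuous_on {0..pi} y" "continuous_on {0..pi} (ddx y)"
  using continuous_on_vector_derivative[OF sl_solutionD(1)[OF assms]]
    absolutely_continuous_imp_continuous_on[OF sl_solutionD(2)[OF assms]] by auto

text \<open>
  The derivative of the Wronskian exists almost everywhere only, but there it equals a continuous
  function, since the terms with \<open>q\<close> cancel. As the Wronskian is absolutely continuous, the formula
  then holds at every point.
\<close>
lemma has_vector_derivative_wronskian: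
  assumes u: "sl_solution q \<nu> u" and v: "sl_solution q \<kappa> v" and x: "x \<in> {0..pi}"
  shows "((\<lambda>x. ddx u x * v x - u x * ddx v x) has_vector_derivative (\<kappa> - \<nu>) * u x * v x)
           (at x within {0..pi})"
proof -
  define W where "W x = ddx u x * v x - u x * ddx v x" for x
  define w where "w x = (\<kappa> - \<nu>) * u x * v x" for x
  note du = sl_solutionD[OF u] and dv = sl_solutionD[OF v]
  note cu = continuous_on_sl_solution[OF u] and cv = continuous_on_sl_solution[OF v]
  have acW: "absolutely_continuous_on_interval 0 pi W"
    unfolding W_def
    by (intro absolutely_continuous_diff absolutely_continuous_mult du(2) dv(2)
        absolutely_continuous_C1[OF du(1) cu(2)] absolutely_continuous_C1[OF dv(1) cv(2)])
  have "AE x in lebesgue. x \<in> {0<..<pi} \<longrightarrow> (W has_vector_derivative w x) (at x)"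
    using du(3) dv(3)
  proof eventually_elim
    case (elim x)
    show ?case
    proof
      assume x: "x \<in> {0<..<pi}"
      then have "at x within {0..pi} = at x" by (intro at_within_Icc_at) auto
      then have "(u has_vector_derivative ddx u x) (at x)" "(v has_vector_derivative ddx v x) (at x)"
        using du(1)[of x] dv(1)[of x] x by auto
      then show "(W has_vector_derivative w x) (at x)"
        unfolding W_def w_def using elim x
        by (auto intro!: derivative_eq_intros simp: algebra_simps)
    qed
  qed
  then obtain N where N: "negligible N" "\<And>x. x \<in> {0<..<pi} - N \<Longrightarrow> (W has_vector_derivative w x) (at x)"
    by (auto simp: negligible_iff_null_sets elim!: AE_E3)
  have int: "W t = W 0 + integral {0..t} w" if "t \<in> {0..pi}" for t
  proof -
    have "(w has_integral (W t - W 0)) {0..t}"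
      using that N
      by (intro fundamental_theorem_of_calculus_absolutely_continuous[where N = N]
          absolutely_continuous_subinterval[OF acW]) auto
    then show ?thesis by (simp add: integral_unique)
  qed
  have "continuous_on {0..pi} w"
    unfolding w_def by (intro continuous_intros cu cv)
  then have "((\<lambda>t. W 0 + integral {0..t} w) has_vector_derivative w x) (at x within {0..pi})"
    using integral_has_vector_derivative[of 0 pi w x] x
    by (auto intro!: derivative_eq_intros)
  then have "(W has_vector_derivative w x) (at x within {0..pi})"
    by (rule has_vector_derivative_transform[OF x, rotated]) (rule int)
  then show ?thesis by (simp only: W_def[abs_def] w_def)
qed

lemma gronwall_zero:
  fixes E E' :: "real \<Rightarrow> real"
  assumes deriv: "\<And>x. x \<in> {a..b} \<Longrightarrow> (E has_vector_derivative E' x) (at x within {a..b})"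
    and bound: "\<And>x. x \<in> {a..b} \<Longrightarrow> E' x \<le> K * E x"
    and init: "E a = 0" and x: "x \<in> {a..b}"
  shows "E x \<le> 0"
proof -
  define G where "G t = exp (- K * t) * E t" for t
  have "continuous_on {a..b} E"
    using deriv by (rule continuous_on_vector_derivative)
  then have cont: "continuous_on {a..b} G"
    unfolding G_def by (intro continuous_intros)
  have "G x \<le> G a"
  proof (rule DERIV_nonpos_imp_decreasing_open[where f = G])
    show "continuous_on {a..x} G" using cont x by (auto intro: continuous_on_subset)
    fix t assume t: "a < t" "t < x"
    then have "at t within {a..b} = at t" using x by (intro at_within_Icc_at) auto
    then have "(E has_real_derivative E' t) (at t)"
      using deriv[of t] t x by (simp add: has_real_derivative_iff_has_vector_derivative)
    then have "(G has_real_derivative exp (- K * t) * (E' t - K * E t)) (at t)"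
      unfolding G_def by (auto intro!: derivative_eq_intros simp: algebra_simps)
    moreover have "exp (- K * t) * (E' t - K * E t) \<le> 0"
      using bound[of t] t x by (intro mult_nonneg_nonpos) auto
    ultimately show "\<exists>d. (G has_real_derivative d) (at t) \<and> d \<le> 0" by blast
  qed (use x in auto)
  then have "exp (- K * x) * E x \<le> 0" by (simp add: G_def init)
  then show ?thesis by (simp add: mult_le_0_iff)
qed

text \<open>
  The energy \<open>E = |u|\<^sup>2 + |w|\<^sup>2\<close> satisfies \<open>E' \<le> K E\<close> and starts at \<open>0\<close>.
\<close>
lemma linear_system_zero:
  fixes u w :: "real \<Rightarrow> complex"
  assumes du: "\<And>x. x \<in> {a..b} \<Longrightarrow> (u has_vector_derivative A x * u x + B x * w x) (at x within {a..b})"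
    and dw: "\<And>x. x \<in> {a..b} \<Longrightarrow> (w has_vector_derivative C x * u x) (at x within {a..b})"
    and cont: "continuous_on {a..b} A" "continuous_on {a..b} B" "continuous_on {a..b} C"
    and init: "u a = 0" "w a = 0" and x: "x \<in> {a..b}"
  shows "u x = 0"
proof -
  obtain MA where MA: "MA \<ge> 0" "\<And>x. x \<in> {a..b} \<Longrightarrow> norm (A x) \<le> MA"
    using continuous_on_interval_bounded[OF cont(1)] by blast
  obtain MB where MB: "MB \<ge> 0" "\<And>x. x \<in> {a..b} \<Longrightarrow> norm (B x) \<le> MB"
    using continuous_on_interval_bounded[OF cont(2)] by blast
  obtain MC where MC: "MC \<ge> 0" "\<And>x. x \<in> {a..b} \<Longrightarrow> norm (C x) \<le> MC"
    using continuous_on_interval_bounded[OF cont(3)] by blast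
  define E where "E t = u t \<bullet> u t + w t \<bullet> w t" for t
  define E' where "E' t = 2 * (u t \<bullet> (A t * u t + B t * w t)) + 2 * (w t \<bullet> (C t * u t))" for t
  have "E x \<le> 0"
  proof (rule gronwall_zero[OF _ _ _ x])
    fix t assume t: "t \<in> {a..b}"
    note inner = bounded_bilinear.has_vector_derivative[OF bounded_bilinear_inner]
    show "(E has_vector_derivative E' t) (at t within {a..b})"
      unfolding E_def
      by (rule has_vector_derivative_eq_rhs[OF has_vector_derivative_add[OF inner[OF du[OF t] du[OF t]] inner[OF dw[OF t] dw[OF t]]]])
        (simp add: E'_def inner_commute)
    have "u t \<bullet> (A t * u t) \<le> norm (u t) * (MA * norm (u t))"
      using MA(2)[OF t] by (intro order_trans[OF norm_cauchy_schwarz] mult_left_mono)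
        (auto simp: norm_mult intro: mult_right_mono)
    moreover have "u t \<bullet> (B t * w t) \<le> norm (u t) * (MB * norm (w t))"
      using MB(2)[OF t] by (intro order_trans[OF norm_cauchy_schwarz] mult_left_mono)
        (auto simp: norm_mult intro: mult_right_mono)
    moreover have "w t \<bullet> (C t * u t) \<le> norm (w t) * (MC * norm (u t))"
      using MC(2)[OF t] by (intro order_trans[OF norm_cauchy_schwarz] mult_left_mono)
        (auto simp: norm_mult intro: mult_right_mono)
    ultimately have "E' t \<le> 2 * MA * (norm (u t))\<^sup>2 + (MB + MC) * (2 * norm (u t) * norm (w t))"
      unfolding E'_def by (simp add: algebra_simps inner_add_right power2_eq_square)
    also have "\<dots> \<le> 2 * MA * ((norm (u t))\<^sup>2 + (norm (w t))\<^sup>2) + (MB + MC) * ((norm (u t))\<^sup>2 + (norm (w t))\<^sup>2)"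
      using MA(1) MB(1) MC(1) sum_squares_bound[of "norm (u t)" "norm (w t)"]
      by (intro add_mono mult_left_mono) auto
    also have "\<dots> = (2 * MA + MB + MC) * E t"
      by (simp add: E_def power2_norm_eq_inner algebra_simps)
    finally show "E' t \<le> (2 * MA + MB + MC) * E t" .
  qed (simp add: E_def init)
  then have "u x \<bullet> u x \<le> 0"
    using inner_ge_zero[of "w x"] unfolding E_def by linarith
  then show ?thesis by (metis inner_gt_zero_iff not_less)
qed

text \<open>
  With \<open>W = u' v - u v'\<close> the derivative of \<open>u\<close> is \<open>(v' / v) u + (1 / v) W\<close> and the derivative of \<open>W\<close> is
  \<open>(\<kappa> - \<nu>) v u\<close>: a linear system whose coefficients are continuous, although \<open>q\<close> need not be.
\<close>
lemma sl_solution_unique_zero: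
  assumes v: "sl_solution q \<kappa> v" "\<And>x. x \<in> {0..pi} \<Longrightarrow> v x \<noteq> 0"
    and u: "sl_solution q \<nu> u" "u 0 = 0" "ddx u 0 = 0" and x: "x \<in> {0..pi}"
  shows "u x = 0"
proof (rule linear_system_zero[OF _ _ _ _ _ _ _ x])
  define W where "W x = ddx u x * v x - u x * ddx v x" for x
  show "(u has_vector_derivative (ddx v t / v t) * u t + (1 / v t) * W t) (at t within {0..pi})"
    if t: "t \<in> {0..pi}" for t
  proof -
    have "(ddx v t / v t) * u t + (1 / v t) * W t = ddx u t"
      using v(2)[OF t] by (simp add: W_def field_simps)
    then show ?thesis using sl_solutionD(1)[OF u(1) t] by simp
  qed
  show "(W has_vector_derivative ((\<kappa> - \<nu>) * v t) * u t) (at t within {0..pi})"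
    if t: "t \<in> {0..pi}" for t
    using has_vector_derivative_wronskian[OF u(1) v(1) t] unfolding W_def by (simp only: mult_ac)
  show "continuous_on {0..pi} (\<lambda>t. ddx v t / v t)" "continuous_on {0..pi} (\<lambda>t. 1 / v t)"
    "continuous_on {0..pi} (\<lambda>t. (\<kappa> - \<nu>) * v t)"
    using v(2) by (auto intro!: continuous_intros continuous_on_sl_solution[OF v(1)])
  show "W 0 = 0" by (simp add: W_def u)
qed (rule u(2))

lemma sl_solution_unique:
  assumes v: "sl_solution q \<kappa> v" "\<And>x. x \<in> {0..pi} \<Longrightarrow> v x \<noteq> 0"
    and y: "sl_solution q \<nu> y" and u: "sl_solution q \<nu> u" and w: "sl_solution q \<nu> w"
    and init: "y 0 = \<alpha> * u 0 + \<beta> * w 0" "ddx y 0 = \<alpha> * ddx u 0 + \<beta> * ddx w 0"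
    and x: "x \<in> {0..pi}"
  shows "y x = \<alpha> * u x + \<beta> * w x"
proof -
  note comb = sl_solution_combination[OF u w, of \<alpha> \<beta>]
  have "1 * y x + (- 1) * (\<alpha> * u x + \<beta> * w x) = 0"
  proof (rule sl_solution_unique_zero[OF v _ _ _ x])
    show "sl_solution q \<nu> (\<lambda>x. 1 * y x + (- 1) * (\<alpha> * u x + \<beta> * w x))"
      by (rule sl_solution_combination[OF y comb])
    show "ddx (\<lambda>x. 1 * y x + (- 1) * (\<alpha> * u x + \<beta> * w x)) 0 = 0"
      using ddx_combination[OF y comb, of 0 1 "- 1"] ddx_combination[OF u w, of 0 \<alpha> \<beta>] init
      by simp
  qed (use init in auto)
  then show ?thesis by (simp add: algebra_simps add_eq_0_iff)
qed

section \<open>The zero-free solution at spectral parameter 0\<close>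

lemma sl_solution_of_real:
  fixes a :: "real \<Rightarrow> real"
  assumes diff: "\<And>x. x \<in> {0..pi} \<Longrightarrow> a differentiable (at x within {0..pi})"
    and ac: "absolutely_continuous_on_interval 0 pi (ddx a)"
    and ae: "AE x in lebesgue. x \<in> {0<..<pi} \<longrightarrow> ddx a differentiable (at x)"
    and nz: "\<And>x. x \<in> {0..pi} \<Longrightarrow> a x \<noteq> 0"
  shows "sl_solution (\<lambda>x. ddx (ddx a) x / a x) 0 (\<lambda>x. of_real (a x))"
proof (rule sl_solutionI[where y' = "\<lambda>x. of_real (ddx a x)"])
  show "((\<lambda>x. complex_of_real (a x)) has_vector_derivative of_real (ddx a x)) (at x within {0..pi})"
    if "x \<in> {0..pi}" for x
    using has_vector_derivative_ddx[OF diff[OF that]]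
    by (intro has_vector_derivative_of_real) (simp add: has_real_derivative_iff_has_vector_derivative)
  show "absolutely_continuous_on_interval 0 pi (\<lambda>x. complex_of_real (ddx a x))"
    by (rule absolutely_continuous_dominated[OF ac ac, where C = 1]) (simp flip: of_real_diff)
  show "AE x in lebesgue. x \<in> {0<..<pi} \<longrightarrow> ((\<lambda>x. complex_of_real (ddx a x))
      has_vector_derivative (of_real (ddx (ddx a) x / a x) - 0) * of_real (a x)) (at x)"
    using ae
  proof (rule AE_mp, intro AE_I2 impI)
    fix x assume *: "x \<in> {0<..<pi} \<longrightarrow> ddx a differentiable (at x)" and x: "x \<in> {0<..<pi}"
    have "(ddx a has_real_derivative ddx (ddx a) x) (at x)"
      using has_vector_derivative_ddx_at[of "ddx a" x] * x
      by (simp add: has_real_derivative_iff_has_vector_derivative)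
    then have "((\<lambda>x. complex_of_real (ddx a x)) has_vector_derivative of_real (ddx (ddx a) x)) (at x)"
      by (rule has_vector_derivative_of_real)
    then show "((\<lambda>x. complex_of_real (ddx a x)) has_vector_derivative
        (of_real (ddx (ddx a) x / a x) - 0) * of_real (a x)) (at x)"
      using nz[of x] x by simp
  qed
qed

text \<open>
  The derivative of \<open>\<surd>F\<close> is \<open>F' r\<close> with \<open>r = 1 / (2 \<surd>F)\<close>, where \<open>F'\<close> is absolutely continuous and \<open>r\<close> is
  continuously differentiable because \<open>F\<close> has no zero.
\<close>
lemma sobolev_H2_sqrt:
  assumes F: "sobolev_H2 F" and pos: "\<And>x. x \<in> {0..pi} \<Longrightarrow> F x > 0"
  defines "a \<equiv> \<lambda>x. sqrt (F x)"
  shows "x \<in> {0..pi} \<Longrightarrow> a differentiable (at x within {0..pi})"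
    and "absolutely_continuous_on_interval 0 pi (ddx a)"
    and "AE x in lebesgue. x \<in> {0<..<pi} \<longrightarrow> ddx a differentiable (at x)"
proof -
  have dF: "(F has_real_derivative ddx F x) (at x within {0..pi})" if "x \<in> {0..pi}" for x
    using F that has_vector_derivative_ddx[of F x]
    by (simp add: sobolev_H2_def has_real_derivative_iff_has_vector_derivative)
  have acF: "absolutely_continuous_on_interval 0 pi (ddx F)"
    using F by (simp add: sobolev_H2_def)
  note cF' = absolutely_continuous_imp_continuous_on[OF acF]
  have apos: "a x > 0" if "x \<in> {0..pi}" for x using pos[OF that] by (simp add: a_def)
  define r where "r x = 1 / (2 * a x)" for x
  have da: "(a has_real_derivative ddx F x * r x) (at x within {0..pi})" if "x \<in> {0..pi}" for x
    using dF[OF that] pos[OF that] unfolding a_def r_def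
    by (auto intro!: derivative_eq_intros simp: field_simps)
  show diff: "a differentiable (at x within {0..pi})" if "x \<in> {0..pi}" for x
    using da[OF that] by (auto simp: has_real_derivative_iff_has_vector_derivative intro: differentiableI_vector)
  have eq: "ddx a x = ddx F x * r x" if "x \<in> {0..pi}" for x
    using da[OF that] that by (intro ddx_eq) (auto simp: has_real_derivative_iff_has_vector_derivative)
  have ca: "continuous_on {0..pi} a"
    using da by (rule DERIV_continuous_on)
  have dr: "(r has_real_derivative - 2 * (ddx F x * r x) / (2 * a x)\<^sup>2) (at x within {0..pi})"
    if "x \<in> {0..pi}" for x
    unfolding r_def using da[OF that] apos[OF that]
    by (auto intro!: derivative_eq_intros simp: r_def power2_eq_square)
  have cr: "continuous_on {0..pi} r"
    using dr by (rule DERIV_continuous_on)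
  have "absolutely_continuous_on_interval 0 pi r"
  proof (rule absolutely_continuous_C1)
    show "(r has_vector_derivative - 2 * (ddx F x * r x) / (2 * a x)\<^sup>2) (at x within {0..pi})"
      if "x \<in> {0..pi}" for x
      using dr[OF that] by (simp add: has_real_derivative_iff_has_vector_derivative)
    show "continuous_on {0..pi} (\<lambda>x. - 2 * (ddx F x * r x) / (2 * a x)\<^sup>2)"
      using apos by (intro continuous_intros cF' cr ca) force
  qed
  then have ack: "absolutely_continuous_on_interval 0 pi (\<lambda>x. ddx F x * r x)"
    by (intro absolutely_continuous_mult acF)
  show "absolutely_continuous_on_interval 0 pi (ddx a)"
    by (rule absolutely_continuous_dominated[OF ack ack, where C = 1]) (simp add: eq)
  have "AE x in lebesgue. x \<in> {0<..<pi} \<longrightarrow> ddx F differentiable (at x)"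
    using F by (simp add: sobolev_H2_def)
  then show "AE x in lebesgue. x \<in> {0<..<pi} \<longrightarrow> ddx a differentiable (at x)"
  proof (rule AE_mp, intro AE_I2 impI)
    fix x assume *: "x \<in> {0<..<pi} \<longrightarrow> ddx F differentiable (at x)" and x: "x \<in> {0<..<pi}"
    then have "at x within {0..pi} = at x" by (intro at_within_Icc_at) auto
    then have "(r has_vector_derivative - 2 * (ddx F x * r x) / (2 * a x)\<^sup>2) (at x)"
      using dr[of x] x by (simp add: has_real_derivative_iff_has_vector_derivative)
    then have "((\<lambda>x. ddx F x * r x) has_vector_derivative
        ddx F x * (- 2 * (ddx F x * r x) / (2 * a x)\<^sup>2) + ddx (ddx F) x * r x) (at x)"
      using has_vector_derivative_ddx_at[of "ddx F" x] * x by (intro has_vector_derivative_mult) auto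
    then have "(ddx a has_vector_derivative
        ddx F x * (- 2 * (ddx F x * r x) / (2 * a x)\<^sup>2) + ddx (ddx F) x * r x) (at x)"
      by (rule has_vector_derivative_transform_within_open[of _ _ x "{0<..<pi}"])
        (use x eq in auto)
    then show "ddx a differentiable (at x)" by (rule differentiableI_vector)
  qed
qed

section \<open>Spherical Bessel functions at the origin\<close>

lemma pos_real_not_nonpos_Ints: "complex_of_real x \<notin> \<int>\<^sub>\<le>\<^sub>0" if "x > 0"
  using that by (auto elim!: nonpos_Ints_cases simp: complex_eq_iff)

text \<open>
  By the functional equation of the Gamma function, consecutive coefficients have ratio
  \<open>- 1 / ((m + 1) (m + k + 3/2))\<close>, of modulus at most \<open>2/3\<close>. The factor \<open>1 ^ m\<close> presents the claim as
  convergence of a power series at the point \<open>1\<close>.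
\<close>
lemma summable_spherical_bessel_j_coeffs:
  "summable (\<lambda>m. (-1) ^ m / (fact m * Gamma (of_nat (m + k) + 3 / 2)) * 1 ^ m :: complex)"
proof -
  define d :: "nat \<Rightarrow> complex" where "d m = (-1) ^ m / (fact m * Gamma (of_nat (m + k) + 3 / 2))" for m
  have rec: "d (Suc m) = - d m / (of_nat (Suc m) * (of_nat (m + k) + 3 / 2))" for m
  proof -
    have "complex_of_real (of_nat (m + k) + 3 / 2) \<notin> \<int>\<^sub>\<le>\<^sub>0"
      by (rule pos_real_not_nonpos_Ints) simp
    then have "Gamma ((of_nat (m + k) + 3 / 2) + 1 :: complex)
        = (of_nat (m + k) + 3 / 2) * Gamma (of_nat (m + k) + 3 / 2)"
      by (intro Gamma_plus1) simp
    moreover have "(of_nat (m + k) + 3 / 2) + 1 = (of_nat (Suc m + k) + 3 / 2 :: complex)" by simp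
    ultimately have G: "Gamma (of_nat (Suc m + k) + 3 / 2 :: complex)
        = (of_nat (m + k) + 3 / 2) * Gamma (of_nat (m + k) + 3 / 2)" by simp
    have arith: "(-1) * s / (n * F * (X * G)) = - (s / (F * G)) / (n * X)" for s n F X G :: complex
      by (simp add: mult_ac)
    show ?thesis unfolding d_def G fact_Suc power_Suc by (rule arith)
  qed
  have "summable (\<lambda>m. d m * 1 ^ m)"
  proof (rule summable_ratio_test[where N = 0 and c = "2 / 3"])
    fix m
    have "1 * (3 / 2) \<le> real (Suc m) * (real (m + k) + 3 / 2)"
      by (intro mult_mono) auto
    moreover have "norm (of_nat (Suc m) * (of_nat (m + k) + 3 / 2) :: complex)
        = real (Suc m) * (real (m + k) + 3 / 2)"
    proof -
      have "(of_nat (Suc m) * (of_nat (m + k) + 3 / 2) :: complex)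
          = of_real (real (Suc m) * (real (m + k) + 3 / 2))" by simp
      then show ?thesis by (simp only: norm_of_real) (simp add: abs_mult)
    qed
    ultimately have n: "3 / 2 \<le> norm (of_nat (Suc m) * (of_nat (m + k) + 3 / 2) :: complex)"
      by simp
    have "norm (d (Suc m)) = norm (d m) / norm (of_nat (Suc m) * (of_nat (m + k) + 3 / 2) :: complex)"
      by (simp only: rec norm_divide norm_minus_cancel)
    also have "\<dots> \<le> norm (d m) / (3 / 2)"
      using n by (intro divide_left_mono) auto
    finally show "norm (d (Suc m) * 1 ^ Suc m) \<le> 2 / 3 * norm (d m * 1 ^ m)" by simp
  qed simp
  then show ?thesis by (simp add: d_def)
qed

text \<open>
  Splitting off \<open>(z / 2) ^ k\<close> leaves a power series in \<open>(z / 2)\<^sup>2\<close>, continuous at \<open>0\<close>, from which the value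
  and the limits at the origin can be read off. Points near the origin suffice for that, and for
  \<open>|z| < 2\<close> the series is evaluated inside the unit disc.
\<close>
lemma spherical_bessel_j_factor:
  assumes "norm z < 2"
  shows "spherical_bessel_j k z = of_real (sqrt pi / 2) * (z / 2) ^ k *
      (\<Sum>m. ((-1) ^ m / (fact m * Gamma (of_nat (m + k) + 3 / 2))) * ((z / 2)\<^sup>2) ^ m)"
proof -
  define d :: "nat \<Rightarrow> complex" where "d m = (-1) ^ m / (fact m * Gamma (of_nat (m + k) + 3 / 2))" for m
  have smb: "summable (\<lambda>m. d m * 1 ^ m)"
    using summable_spherical_bessel_j_coeffs by (simp only: d_def)
  have "norm (z / 2) < 1" using assms by (simp add: norm_divide)
  then have "norm ((z / 2)\<^sup>2) < norm (1::complex)"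
    by (simp add: norm_power power_less_one_iff)
  then have "summable (\<lambda>m. d m * ((z / 2)\<^sup>2) ^ m)" by (rule powser_inside[OF smb])
  then have "(\<Sum>m. (z / 2) ^ k * (d m * ((z / 2)\<^sup>2) ^ m)) = (z / 2) ^ k * (\<Sum>m. d m * ((z / 2)\<^sup>2) ^ m)"
    by (rule suminf_mult)
  moreover have "d m * (z / 2) ^ (2 * m + k) = (z / 2) ^ k * (d m * ((z / 2)\<^sup>2) ^ m)" for m
    unfolding power_add power_mult by (simp only: mult_ac)
  ultimately have "(\<Sum>m. d m * (z / 2) ^ (2 * m + k)) = (z / 2) ^ k * (\<Sum>m. d m * ((z / 2)\<^sup>2) ^ m)"
    by (simp only:)
  then show ?thesis
    unfolding spherical_bessel_j_def d_def by (simp only: mult.assoc)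
qed

lemma Gamma_three_half: "Gamma (3 / 2 :: complex) = of_real (sqrt pi / 2)"
proof -
  have "Gamma (1 / 2 + 1 :: complex) = 1 / 2 * Gamma (1 / 2)"
    using pos_real_not_nonpos_Ints[of "1 / 2"] by (intro Gamma_plus1) simp
  then show ?thesis by (simp add: Gamma_one_half_complex)
qed

lemma Gamma_five_half: "Gamma (5 / 2 :: complex) = of_real (3 * sqrt pi / 4)"
proof -
  have "Gamma (3 / 2 + 1 :: complex) = 3 / 2 * Gamma (3 / 2)"
    using pos_real_not_nonpos_Ints[of "3 / 2"] by (intro Gamma_plus1) simp
  then show ?thesis by (simp add: Gamma_three_half)
qed

lemma spherical_bessel_j_at_0: "spherical_bessel_j k 0 = (if k = 0 then 1 else 0)"
proof -
  have *: "(\<Sum>m. c m * (0\<^sup>2) ^ m) = c 0" for c :: "nat \<Rightarrow> complex"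
    using powser_zero[of c] by simp
  show ?thesis
    using spherical_bessel_j_factor[of 0 k] *[of "\<lambda>m. (-1) ^ m / (fact m * Gamma (of_nat (m + k) + 3 / 2))"]
    by (cases "k = 0") (simp_all add: Gamma_three_half power_0_left)
qed

lemma spherical_bessel_j_quotient_at_0:
  "((\<lambda>r. spherical_bessel_j (Suc k) (r * z) / r) \<longlongrightarrow> (if k = 0 then z / 3 else 0)) (at 0)"
proof -
  define d :: "nat \<Rightarrow> complex" where
    "d m = (-1) ^ m / (fact m * Gamma (of_nat (m + Suc k) + 3 / 2))" for m
  define P where "P w = (\<Sum>m. d m * w ^ m)" for w
  define Q where "Q r = of_real (sqrt pi / 2) * (z / 2) * (r * z / 2) ^ k * P ((r * z / 2)\<^sup>2)" for r
  have "isCont P 0"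
    unfolding P_def
    by (rule isCont_powser[where K = 1]) (use summable_spherical_bessel_j_coeffs[of "Suc k"] in \<open>simp_all add: d_def\<close>)
  then have "isCont P ((0 * z / 2)\<^sup>2)" by simp
  then have "isCont (\<lambda>r. P ((r * z / 2)\<^sup>2)) 0"
    by (rule isCont_o2[rotated]) (intro continuous_intros, simp)
  then have "isCont Q 0"
    unfolding Q_def by (intro continuous_intros) auto
  then have lim: "(Q \<longlongrightarrow> Q 0) (at 0)" by (simp add: isCont_def)
  have "P 0 = 1 / Gamma (of_nat (Suc k) + 3 / 2)"
    unfolding P_def using powser_zero[of d] by (simp add: d_def)
  then have Q0: "Q 0 = (if k = 0 then z / 3 else 0)"
    by (auto simp: Q_def Gamma_five_half field_simps)
  have "eventually (\<lambda>r. norm (r * z) < 2) (at 0)"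
  proof -
    have "((\<lambda>r. norm (r * z)) \<longlongrightarrow> norm (0 * z)) (at 0)" by (intro tendsto_intros)
    then show ?thesis by (rule order_tendstoD(2)) simp
  qed
  then have "eventually (\<lambda>r. Q r = spherical_bessel_j (Suc k) (r * z) / r) (at 0)"
    using eventually_neq_at_within[of 0 0 UNIV]
  proof eventually_elim
    case (elim r)
    then show ?case
      by (simp add: spherical_bessel_j_factor Q_def P_def d_def)
  qed
  with lim have "((\<lambda>r. spherical_bessel_j (Suc k) (r * z) / r) \<longlongrightarrow> Q 0) (at 0)"
    by (simp cong: filterlim_cong add: tendsto_cong)
  then show ?thesis by (simp only: Q0)
qed

lemma extend_to_0_bessel:
  "extend_to_0 (\<lambda>r. spherical_bessel_j (2 * n + 1) (r * z) / r) 0 = (if n = 0 then z / 3 else 0)"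
  using tendsto_Lim[OF _ spherical_bessel_j_quotient_at_0[of "2 * n" z]]
  by (simp add: extend_to_0_def)

lemma extend_to_0_sin: "extend_to_0 (\<lambda>r. sin (r * z) / r) 0 = z"
proof -
  have "((\<lambda>r. sin (r * z)) has_field_derivative z) (at 0)"
    by (auto intro!: derivative_eq_intros)
  then have "((\<lambda>r. sin (r * z) / r) \<longlongrightarrow> z) (at 0)"
    by (simp add: has_field_derivative_iff)
  then show ?thesis by (simp add: extend_to_0_def tendsto_Lim)
qed

section \<open>The identities for the Neumann series coefficients\<close>

theorem mainTheorem2:
  fixes F a q :: "real \<Rightarrow> real" and h c :: real
    and \<mu> :: "nat \<Rightarrow> complex"
    and \<phi> S y :: "complex \<Rightarrow> real \<Rightarrow> complex"
    and f :: "complex \<Rightarrow> complex"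
    and g s :: "nat \<Rightarrow> real \<Rightarrow> complex"
  assumes "sobolev_H2 F"
    and "\<forall>x\<in>{0..pi}. F x > 0"
    and "a = (\<lambda>x. sqrt (F x))"
    and "q = (\<lambda>x. ddx (ddx a) x / a x)"
    and "h = ddx a 0 / a 0"
    and "c \<noteq> 0"
    and "range (\<lambda>k. (\<mu> k)\<^sup>2) = sl_spectrum q h"
    and "\<forall>\<rho>. (\<forall>k. \<rho>\<^sup>2 \<noteq> (\<mu> k)\<^sup>2) \<longrightarrow>
           sl_solution q (\<rho>\<^sup>2) (y \<rho>) \<and>
           ddx (y \<rho>) 0 - of_real h * y \<rho> 0 = of_real c \<and> y \<rho> pi = 0"
    and "f = (\<lambda>\<rho>. y \<rho> 0)"
    and "\<forall>\<rho>. sl_solution q (\<rho>\<^sup>2) (\<phi> \<rho>) \<and> \<phi> \<rho> 0 = 1 \<and> ddx (\<phi> \<rho>) 0 = of_real h"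
    and "\<forall>\<rho>. sl_solution q (\<rho>\<^sup>2) (S \<rho>) \<and> S \<rho> 0 = 0 \<and> ddx (S \<rho>) 0 = 1"
    and "nsbf_phi g \<phi>"
    and "nsbf_S s S"
  shows
    "(\<forall>\<rho>. \<rho> \<noteq> 0 \<and> (\<forall>k. \<rho>\<^sup>2 \<noteq> (\<mu> k)\<^sup>2) \<longrightarrow>
        f \<rho> * (\<Sum>n. (-1) ^ n * g n pi * spherical_bessel_j (2 * n) (\<rho> * of_real pi))
        + of_real c / \<rho> * (\<Sum>n. (-1) ^ n * s n pi * spherical_bessel_j (2 * n + 1) (\<rho> * of_real pi))
        = - f \<rho> * cos (\<rho> * of_real pi) - of_real c * (sin (\<rho> * of_real pi) / \<rho>))
     \<and> f 0 * g 0 pi + of_real (pi * c / 3) * s 0 pi = - f 0 - of_real (pi * c)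
     \<and> (\<forall>\<rho>. (\<exists>k. \<rho>\<^sup>2 = (\<mu> k)\<^sup>2) \<longrightarrow>
        (\<Sum>n. (-1) ^ n * g n pi * spherical_bessel_j (2 * n) (\<rho> * of_real pi))
        = - cos (\<rho> * of_real pi))"
proof -
  have pos: "F x > 0" "a x > 0" if "x \<in> {0..pi}" for x
    using assms(2,3) that by auto
  note H2 = sobolev_H2_sqrt[OF assms(1) pos(1), folded assms(3)]
  have sol_a: "sl_solution q 0 (\<lambda>x. of_real (a x))"
    unfolding assms(4) using H2 pos(2) by (intro sl_solution_of_real) force+
  have a_nz: "complex_of_real (a x) \<noteq> 0" if "x \<in> {0..pi}" for x
    using pos(2)[OF that] by simp
  note phi = assms(10)[rule_format] and S = assms(11)[rule_format]
  \<comment> \<open>Every solution is a combination of \<open>\<phi>\<close> and \<open>S\<close> whose coefficients are its Cauchy data at \<open>0\<close>.\<close>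
  have decomp: "u x = u 0 * \<phi> \<rho> x + (ddx u 0 - of_real h * u 0) * S \<rho> x"
    if "sl_solution q (\<rho>\<^sup>2) u" "x \<in> {0..pi}" for u \<rho> x
    by (rule sl_solution_unique[OF sol_a _ that(1) conjunct1[OF phi] conjunct1[OF S] _ _ that(2)])
      (use a_nz in \<open>simp_all add: phi S\<close>)
  have phi_sums: "(\<lambda>n. (-1) ^ n * g n pi * spherical_bessel_j (2 * n) (\<rho> * of_real pi))
      sums (\<phi> \<rho> pi - cos (\<rho> * of_real pi))" for \<rho>
    using assms(12) by (simp add: nsbf_phi_def)
  have S_sums: "(\<lambda>n. (-1) ^ n * s n pi *
        extend_to_0 (\<lambda>r. spherical_bessel_j (2 * n + 1) (r * of_real pi) / r) \<rho>)
      sums (S \<rho> pi - extend_to_0 (\<lambda>r. sin (r * of_real pi) / r) \<rho>)" for \<rho>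
    using assms(13) by (simp add: nsbf_S_def)
  have spec: "\<phi> \<rho> pi = 0" if "\<rho>\<^sup>2 \<in> sl_spectrum q h" for \<rho>
  proof -
    obtain u where u: "sl_solution q (\<rho>\<^sup>2) u" "\<exists>x\<in>{0..pi}. u x \<noteq> 0"
      "ddx u 0 - of_real h * u 0 = 0" "u pi = 0"
      using \<open>\<rho>\<^sup>2 \<in> sl_spectrum q h\<close> by (auto simp: sl_spectrum_def)
    have eq: "u x = u 0 * \<phi> \<rho> x" if "x \<in> {0..pi}" for x
      using decomp[OF u(1) that] u(3) by simp
    then have "u 0 \<noteq> 0" using u(2) by (metis mult_zero_left)
    then show ?thesis using eq[of pi] u(4) by simp
  qed
  have not_spec: "\<rho>\<^sup>2 \<in> sl_spectrum q h \<longleftrightarrow> (\<exists>k. \<rho>\<^sup>2 = (\<mu> k)\<^sup>2)" for \<rho>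
    using assms(7) by (auto simp flip: assms(7))
  have char: "f \<rho> * \<phi> \<rho> pi + of_real c * S \<rho> pi = 0" if "\<forall>k. \<rho>\<^sup>2 \<noteq> (\<mu> k)\<^sup>2" for \<rho>
  proof -
    have "sl_solution q (\<rho>\<^sup>2) (y \<rho>)" "ddx (y \<rho>) 0 - of_real h * y \<rho> 0 = of_real c" "y \<rho> pi = 0"
      using assms(8) that by blast+
    then show ?thesis using decomp[of \<rho> "y \<rho>" pi] by (simp add: assms(9))
  qed
  have part1: "f \<rho> * (\<Sum>n. (-1) ^ n * g n pi * spherical_bessel_j (2 * n) (\<rho> * of_real pi))
        + of_real c / \<rho> * (\<Sum>n. (-1) ^ n * s n pi * spherical_bessel_j (2 * n + 1) (\<rho> * of_real pi))
        = - f \<rho> * cos (\<rho> * of_real pi) - of_real c * (sin (\<rho> * of_real pi) / \<rho>)"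
    if "\<rho> \<noteq> 0" "\<forall>k. \<rho>\<^sup>2 \<noteq> (\<mu> k)\<^sup>2" for \<rho>
  proof -
    have "(\<lambda>n. \<rho> * ((-1) ^ n * s n pi * (spherical_bessel_j (2 * n + 1) (\<rho> * of_real pi) / \<rho>)))
        sums (\<rho> * (S \<rho> pi - sin (\<rho> * of_real pi) / \<rho>))"
      using S_sums[of \<rho>] \<open>\<rho> \<noteq> 0\<close> by (intro sums_mult) (simp add: extend_to_0_def)
    then have "(\<lambda>n. (-1) ^ n * s n pi * spherical_bessel_j (2 * n + 1) (\<rho> * of_real pi))
        sums (\<rho> * (S \<rho> pi - sin (\<rho> * of_real pi) / \<rho>))"
      using \<open>\<rho> \<noteq> 0\<close> by simp
    from sums_unique[OF this, symmetric] sums_unique[OF phi_sums[of \<rho>], symmetric] show ?thesis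
      using char[OF that(2)] \<open>\<rho> \<noteq> 0\<close> by (simp only:) (simp add: algebra_simps)
  qed
  \<comment> \<open>At \<open>\<rho> = 0\<close> the solution \<open>\<phi>\<close> is \<open>a / a(0)\<close>, which does not vanish at \<open>\<pi>\<close>.\<close>
  have zero: "\<forall>k. 0\<^sup>2 \<noteq> (\<mu> k)\<^sup>2"
  proof (rule ccontr)
    assume "\<not> ?thesis"
    then have "\<phi> 0 pi = 0" using spec[of 0] not_spec[of 0] by auto
    have "ddx (\<lambda>x. complex_of_real (a x)) 0 = of_real (ddx a 0)"
      using has_vector_derivative_ddx[OF H2(1)[of 0]]
      by (intro ddx_eq has_vector_derivative_of_real)
        (simp_all add: has_real_derivative_iff_has_vector_derivative)
    also have "\<dots> = of_real h * of_real (a 0)"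
      using pos(2)[of 0] by (simp add: assms(5))
    finally have "complex_of_real (a pi) = of_real (a 0) * \<phi> 0 pi"
      using decomp[of 0 "\<lambda>x. of_real (a x)" pi] sol_a by simp
    then show False using \<open>\<phi> 0 pi = 0\<close> a_nz[of pi] by simp
  qed
  have part2: "f 0 * g 0 pi + of_real (pi * c / 3) * s 0 pi = - f 0 - of_real (pi * c)"
  proof -
    have "(\<lambda>n. if n = 0 then g n pi else 0) sums (\<phi> 0 pi - 1)"
      using phi_sums[of 0] by (simp add: spherical_bessel_j_at_0 if_distrib cong: if_cong)
    then have g0: "g 0 pi = \<phi> 0 pi - 1"
      using sums_single[of 0 "\<lambda>n. g n pi"] by (rule sums_unique2[rotated])
    have "(\<lambda>n. if n = 0 then s n pi * (of_real pi / 3) else 0) sums (S 0 pi - of_real pi)"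
      using S_sums[of 0] by (simp only: extend_to_0_bessel extend_to_0_sin)
        (simp add: if_distrib cong: if_cong)
    then have s0: "s 0 pi * (of_real pi / 3) = S 0 pi - of_real pi"
      using sums_single[of 0 "\<lambda>n. s n pi * (of_real pi / 3)"] by (rule sums_unique2[rotated])
    have "f 0 * g 0 pi + of_real (pi * c / 3) * s 0 pi
        = f 0 * g 0 pi + of_real c * (s 0 pi * (of_real pi / 3))" by simp
    also have "\<dots> = f 0 * (\<phi> 0 pi - 1) + of_real c * (S 0 pi - of_real pi)"
      by (simp only: g0 s0)
    also have "\<dots> = (f 0 * \<phi> 0 pi + of_real c * S 0 pi) - f 0 - of_real (pi * c)"
      by (simp add: algebra_simps)
    finally show ?thesis using char[OF zero] by simp
  qed
  have part3: "(\<Sum>n. (-1) ^ n * g n pi * spherical_bessel_j (2 * n) (\<rho> * of_real pi))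
        = - cos (\<rho> * of_real pi)" if "\<exists>k. \<rho>\<^sup>2 = (\<mu> k)\<^sup>2" for \<rho>
    using sums_unique[OF phi_sums[of \<rho>]] spec[of \<rho>] not_spec[of \<rho>] that by simp
  show ?thesis using part1 part2 part3 by blast
qed

end
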